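(* Let $n \geq 2$ be an integer, let $S$ be a ring and let $x \in S$ be an $n$-potent element such that the elements $x, x^2, \dots, x^{n-1}$ are all distinct. Then, for a positive integer $m$, $x^m = x$ if and only if $m \equiv 1 \pmod{n-1}$.
   Context: Rings are associative with unity, not necessarily commutative. An element $x$ of a ring is $n$-potent if $x^n = x$. *)

theory Defs
  imports "HOL-Algebra.Ring" "HOL-Number_Theory.Cong"
begin

definition n_potent :: "('a, 'b) monoid_scheme \<Rightarrow> nat \<Rightarrow> 'a \<Rightarrow> bool" where
  "n_potent S n x \<longleftrightarrow> x \<in> carrier S \<and> x [^]\<^bsub>S\<^esub> n = x"

end

theory Submission
  imports Defs
begin

text \<open>
  Since \<open>x\<^sup>n = x\<close>, the sequence \<open>x, x\<^sup>2, x\<^sup>3, \<dots>\<close> is periodic with period \<open>n - 1\<close>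
  (\<open>pow_add_mult_period\<close>), so each power with a positive exponent \<open>m\<close> equals the power whose
  exponent \<open>r\<close> is the representative of \<open>m\<close> modulo \<open>n - 1\<close> in the window \<open>{1..n - 1}\<close>. The
  powers in this window are distinct, so \<open>x\<^sup>m = x\<close> exactly when \<open>r = 1\<close>.
\<close>

text \<open>
  Multiplying \<open>x [^] Suc p = x\<close> by \<open>x [^] (k - 1)\<close> shifts the exponent by \<open>p\<close>. This needs
  \<open>k > 0\<close>: when \<open>x\<close> is not invertible, \<open>x [^] p\<close> can be an idempotent other than the identity
  \<open>x [^] 0\<close>.
\<close>
lemma (in monoid) pow_add_mult_period:
  fixes k p q :: nat
  assumes x: "x \<in> carrier G" and period: "x [^] Suc p = x" and "k > 0"
  shows "x [^] (k + q * p) = x [^] k"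
proof (induction q)
  case 0
  show ?case by simp
next
  case (Suc q)
  define j where "j = k - 1 + q * p"
  have "x [^] (k + Suc q * p) = x [^] (j + Suc p)"
    using \<open>k > 0\<close> by (simp add: j_def algebra_simps del: nat_pow_Suc)
  also have "\<dots> = x [^] j \<otimes> x [^] Suc p"
    using x by (simp only: nat_pow_mult)
  also have "\<dots> = x [^] Suc j"
    by (subst period) simp
  also have "Suc j = k + q * p"
    using \<open>k > 0\<close> by (simp add: j_def)
  finally show ?case using Suc.IH by simp
qed

theorem lemma2p8:
  fixes S :: "('a, 'b) ring_scheme" and x :: 'a and n m :: nat
  assumes "n \<ge> 2"
    and "ring S"
    and "n_potent S n x"
    and "inj_on (\<lambda>i::nat. x [^]\<^bsub>S\<^esub> i) {1..n - 1}"
    and "m > 0"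
  shows "x [^]\<^bsub>S\<^esub> m = x \<longleftrightarrow> [m = 1] (mod (n - 1))"
proof -
  interpret ring S by fact
  have x: "x \<in> carrier S" and pot: "x [^]\<^bsub>S\<^esub> n = x"
    using assms(3) by (auto simp: n_potent_def)
  define p where "p = n - 1"
  have p: "p > 0" "n = Suc p"
    using \<open>n \<ge> 2\<close> by (auto simp: p_def)
  \<comment> \<open>Reducing \<open>m - 1\<close> instead of \<open>m\<close> puts the representative in \<open>{1..p}\<close> rather than
    \<open>{0..<p}\<close>, where periodicity could fail at exponent \<open>0\<close>.\<close>
  define r where "r = Suc ((m - 1) mod p)"
  have r: "r \<in> {1..p}"
    using p(1) by (simp add: r_def Suc_le_eq)
  have m: "m = r + ((m - 1) div p) * p"
    using \<open>m > 0\<close> mod_div_mult_eq[of "m - 1" p] by (simp add: r_def)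
  have "x [^]\<^bsub>S\<^esub> m = x [^]\<^bsub>S\<^esub> r"
    using pow_add_mult_period[of x p r "(m - 1) div p"] x pot p(2) r m by simp
  then have "x [^]\<^bsub>S\<^esub> m = x \<longleftrightarrow> x [^]\<^bsub>S\<^esub> r = x [^]\<^bsub>S\<^esub> (1::nat)"
    using x by simp
  also have "\<dots> \<longleftrightarrow> r = 1"
    using inj_on_eq_iff[OF assms(4), of r 1] r p by simp
  also have "\<dots> \<longleftrightarrow> p dvd m - 1"
    by (simp add: r_def dvd_eq_mod_eq_0)
  also have "\<dots> \<longleftrightarrow> [m = 1] (mod p)"
    using \<open>m > 0\<close> by (simp add: cong_altdef_nat)
  finally show ?thesis by (simp add: p_def)
qed

end
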